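(* For any fixed positive integer $d$, the sequence $(\alpha_n^d)_n$ is strictly increasing for all sufficiently large $n$; that is, there is $N$ such that $\alpha_{n+1}^d>\alpha_n^d$ for all $n\geq N$.
   Context: $\mathbb{Z}_n$ is the ring of integers modulo $n$; a vector $(v_1,\dots,v_d)\in\mathbb{Z}_n^d$ is zero-sum-free if no non-empty subset of its components sums to $0$ in $\mathbb{Z}_n$; $\alpha_n^d$ is the number of such vectors. *)

theory Defs
  imports "HOL-Number_Theory.Number_Theory"
begin

(* A vector (v_1, ..., v_d) is a function on the index set {1..d}. A subset of the components is
   given by a set of indices, so equal entries at different positions count separately. *)
definition zero_sum_free :: "('a, 'm) ring_scheme \<Rightarrow> nat \<Rightarrow> (nat \<Rightarrow> 'a) \<Rightarrow> bool" where
  "zero_sum_free R d v \<longleftrightarrow>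
     (\<forall>I. I \<subseteq> {1..d} \<and> I \<noteq> {} \<longrightarrow> finsum R v I \<noteq> \<zero>\<^bsub>R\<^esub>)"

(* The extensional function space gives each vector exactly one representing function.
   For n = 0 the carrier of the residue ring is empty, so the value there is a dummy. *)
definition zsf_vectors :: "nat \<Rightarrow> nat \<Rightarrow> (nat \<Rightarrow> int) set" where
  "zsf_vectors d n =
     {v \<in> {1..d} \<rightarrow>\<^sub>E carrier (residue_ring (int n)). zero_sum_free (residue_ring (int n)) d v}"

definition \<alpha> :: "nat \<Rightarrow> nat \<Rightarrow> nat" where
  "\<alpha> d n = card (zsf_vectors d n)"

end

theory Submission
  imports Defs
begin

text \<open>
  Each of the \<open>M = 2\<^sup>d - 1\<close> equations ``the components indexed by \<open>I\<close> sum to 0'' has exactly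
  \<open>n\<^sup>d\<^sup>-\<^sup>1\<close> solutions modulo \<open>n\<close>, and two distinct equations have \<open>n\<^sup>d\<^sup>-\<^sup>2\<close> common solutions,
  because some index occurs in only one of them and can be eliminated. The Bonferroni inequalities
  then give \<open>n\<^sup>d\<^sup>-\<^sup>1 (n - M) \<le> \<alpha>\<^sub>n \<le> n\<^sup>d\<^sup>-\<^sup>1 (n - M + M\<^sup>2 / n)\<close>, and once \<open>n > M\<^sup>2\<close> the upper bound
  for \<open>n\<close> lies below the lower bound for \<open>n + 1\<close>.
\<close>

lemma finsum_residue_ring:
  fixes n :: int
  assumes "n > 1" "finite I" "\<And>i. i \<in> I \<Longrightarrow> v i \<in> {0..<n}"
  shows "finsum (residue_ring n) v I = (\<Sum>i\<in>I. v i) mod n"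
  using assms(2,3)
proof (induction I rule: finite_induct)
  interpret residues n "residue_ring n"
    by unfold_locales (use assms(1) in auto)
  case empty
  then show ?case by (simp add: res_zero_eq)
next
  interpret residues n "residue_ring n"
    by unfold_locales (use assms(1) in auto)
  case (insert i I)
  have *: "v \<in> I \<rightarrow> carrier (residue_ring n)" "v i \<in> carrier (residue_ring n)"
    using insert.prems by (auto simp: res_carrier_eq)
  then show ?case
    using insert finsum_insert[OF insert.hyps(1,2) *]
    by (simp add: res_add_eq mod_simps)
qed

text \<open>Since \<open>i\<close> lies in \<open>I\<close>, the equation fixes \<open>v i\<close>
  modulo \<open>n\<close> from the other coordinates, so forgetting coordinate \<open>i\<close> is a
  bijection. The hypothesis on \<open>Q\<close> says that \<open>Q\<close> does not look at
  coordinate \<open>i\<close>; carrying such a \<open>Q\<close> along lets a second equation be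
  imposed at the same time.\<close>

lemma card_elim_coordinate:
  fixes n :: int
  assumes n: "n > 0" and D: "finite D" "I \<subseteq> D" "i \<in> I"
    and Q: "\<And>v w. (\<And>k. k \<in> D - {i} \<Longrightarrow> v k = w k) \<Longrightarrow> Q v \<longleftrightarrow> Q w"
  shows "card {v \<in> D \<rightarrow>\<^sub>E {0..<n}. n dvd sum v I \<and> Q v} = card {w \<in> (D - {i}) \<rightarrow>\<^sub>E {0..<n}. Q w}"
proof -
  \<comment> \<open>\<open>f\<close> forgets coordinate \<open>i\<close>; \<open>g\<close> restores
    it as the only residue that makes the sum over \<open>I\<close> vanish modulo
    \<open>n\<close>.\<close>
  define f where "f v = restrict v (D - {i})" for v :: "'a \<Rightarrow> int"
  define g where "g w = w(i := (- sum w (I - {i})) mod n)" for w :: "'a \<Rightarrow> int"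
  have fin: "finite I" using D finite_subset by blast
  have split: "sum v I = v i + sum v (I - {i})" for v :: "'a \<Rightarrow> int"
    using fin D(3) by (simp add: sum.remove)
  have sum_f: "sum (f v) (I - {i}) = sum v (I - {i})" for v
    using D by (intro sum.cong) (auto simp: f_def)
  have sum_g: "sum (g w) (I - {i}) = sum w (I - {i})" for w
    by (intro sum.cong) (auto simp: g_def)
  have Qf: "Q (f v) \<longleftrightarrow> Q v" for v by (rule Q) (auto simp: f_def)
  have Qg: "Q (g w) \<longleftrightarrow> Q w" for w by (rule Q) (auto simp: g_def)
  have "bij_betw f {v \<in> D \<rightarrow>\<^sub>E {0..<n}. n dvd sum v I \<and> Q v} {w \<in> (D - {i}) \<rightarrow>\<^sub>E {0..<n}. Q w}"
  proof (rule bij_betw_byWitness[where f' = g])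
    show "\<forall>v\<in>{v \<in> D \<rightarrow>\<^sub>E {0..<n}. n dvd sum v I \<and> Q v}. g (f v) = v"
    proof safe
      fix v assume v: "v \<in> D \<rightarrow>\<^sub>E {0..<n}" "n dvd sum v I"
      have "v i \<in> {0..<n}" using v D by auto
      \<comment> \<open>The two sides differ by a multiple of \<open>n\<close>, and
        \<open>v i\<close> is already reduced, so the value inserted by \<open>g\<close> is
        \<open>v i\<close> itself.\<close>
      moreover have "(- sum v (I - {i})) mod n = v i mod n"
      proof -
        have "- sum v (I - {i}) - v i = - sum v I" by (simp add: split)
        then show ?thesis using v(2) by (simp only: mod_eq_dvd_iff dvd_minus_iff)
      qed
      ultimately have "(- sum (f v) (I - {i})) mod n = v i" by (simp add: sum_f)
      then have "g (f v) k = v k" for k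
        using PiE_arb[OF v(1), of k] by (simp add: g_def f_def)
      then show "g (f v) = v" by (rule ext)
    qed
    show "\<forall>w\<in>{w \<in> (D - {i}) \<rightarrow>\<^sub>E {0..<n}. Q w}. f (g w) = w"
    proof safe
      fix w assume w: "w \<in> (D - {i}) \<rightarrow>\<^sub>E {0..<n}"
      \<comment> \<open>At \<open>i\<close> and outside \<open>D\<close> both sides are
        \<open>undefined\<close>, by extensionality of \<open>w\<close>.\<close>
      have "f (g w) k = w k" for k
        using PiE_arb[OF w, of k] by (simp add: g_def f_def)
      then show "f (g w) = w" by (rule ext)
    qed
    show "f ` {v \<in> D \<rightarrow>\<^sub>E {0..<n}. n dvd sum v I \<and> Q v} \<subseteq> {w \<in> (D - {i}) \<rightarrow>\<^sub>E {0..<n}. Q w}"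
    proof (intro image_subsetI CollectI conjI)
      fix v assume "v \<in> {v \<in> D \<rightarrow>\<^sub>E {0..<n}. n dvd sum v I \<and> Q v}"
      then have v: "v \<in> D \<rightarrow>\<^sub>E {0..<n}" "Q v" by auto
      show "f v \<in> (D - {i}) \<rightarrow>\<^sub>E {0..<n}"
        using v(1) unfolding f_def by (intro restrict_PiE_iff[THEN iffD2]) auto
      show "Q (f v)" using v(2) Qf by simp
    qed
    show "g ` {w \<in> (D - {i}) \<rightarrow>\<^sub>E {0..<n}. Q w} \<subseteq> {v \<in> D \<rightarrow>\<^sub>E {0..<n}. n dvd sum v I \<and> Q v}"
    proof (intro image_subsetI CollectI conjI)
      fix w assume "w \<in> {w \<in> (D - {i}) \<rightarrow>\<^sub>E {0..<n}. Q w}"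
      then have w: "w \<in> (D - {i}) \<rightarrow>\<^sub>E {0..<n}" "Q w" by auto
      show "Q (g w)" using w Qg by simp
      show "g w \<in> D \<rightarrow>\<^sub>E {0..<n}"
        using w(1) n D by (auto simp: g_def PiE_iff extensional_def)
      have "((- sum w (I - {i})) mod n + sum w (I - {i})) mod n = 0"
        by (simp add: mod_simps)
      then show "n dvd sum (g w) I"
        unfolding split sum_g by (simp add: g_def mod_0_imp_dvd)
    qed
  qed
  then show ?thesis by (rule bij_betw_same_card)
qed

text \<open>Eliminate any index of \<open>I\<close> with a trivial side condition. The quotient of
  reals avoids an exponent with truncated subtraction.\<close>

lemma card_zero_sum:
  fixes n :: nat
  assumes "n > 0" "finite D" "I \<subseteq> D" "I \<noteq> {}"
  shows "real (card {v \<in> D \<rightarrow>\<^sub>E {0..<int n}. int n dvd sum v I}) = real n ^ card D / real n"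
proof -
  obtain i where i: "i \<in> I" using assms(4) by blast
  have "card {v \<in> D \<rightarrow>\<^sub>E {0..<int n}. int n dvd sum v I} = n ^ (card D - 1)"
    using card_elim_coordinate[of "int n" D I i "\<lambda>_. True"] assms i by (auto simp: card_PiE)
  moreover have "card D \<ge> 1"
    using assms i by (metis One_nat_def Suc_leI card_gt_0_iff empty_iff subsetD)
  ultimately show ?thesis using assms(1) by (cases "card D") auto
qed

lemma card_two_zero_sums:
  fixes n :: nat
  assumes n: "n > 0" and D: "finite D" "I \<subseteq> D" "J \<subseteq> D" "I \<noteq> {}" "J \<noteq> {}" "I \<noteq> J"
  shows "real (card ({v \<in> D \<rightarrow>\<^sub>E {0..<int n}. int n dvd sum v I} \<inter>
           {v \<in> D \<rightarrow>\<^sub>E {0..<int n}. int n dvd sum v J})) = real n ^ card D / real n ^ 2"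
proof -
  \<comment> \<open>With \<open>i\<close> in \<open>I\<close> but not in \<open>J\<close>, the
    equation for \<open>I\<close> eliminates \<open>i\<close> and leaves the one for
    \<open>J\<close> untouched, a single equation over \<open>D - {i}\<close>.\<close>
  have *: "real (card ({v \<in> D \<rightarrow>\<^sub>E {0..<int n}. int n dvd sum v I} \<inter>
           {v \<in> D \<rightarrow>\<^sub>E {0..<int n}. int n dvd sum v J})) = real n ^ card D / real n ^ 2"
    if D: "I \<subseteq> D" "J \<subseteq> D" "J \<noteq> {}" and i: "i \<in> I" "i \<notin> J" for I J i
  proof -
    have "{v \<in> D \<rightarrow>\<^sub>E {0..<int n}. int n dvd sum v I} \<inter> {v \<in> D \<rightarrow>\<^sub>E {0..<int n}. int n dvd sum v J}
        = {v \<in> D \<rightarrow>\<^sub>E {0..<int n}. int n dvd sum v I \<and> int n dvd sum v J}" by auto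
    also have "card \<dots> = card {w \<in> (D - {i}) \<rightarrow>\<^sub>E {0..<int n}. int n dvd sum w J}"
    proof (rule card_elim_coordinate)
      fix v w :: "'a \<Rightarrow> int" assume "\<And>k. k \<in> D - {i} \<Longrightarrow> v k = w k"
      then have "sum v J = sum w J" using D i by (intro sum.cong) auto
      then show "int n dvd sum v J \<longleftrightarrow> int n dvd sum w J" by simp
    qed (use n assms(2) D i in auto)
    also have "real \<dots> = real n ^ card (D - {i}) / real n"
      by (rule card_zero_sum) (use n assms(2) D i in auto)
    also have "\<dots> = real n ^ card D / real n ^ 2"
    proof -
      have "card D = Suc (card (D - {i}))"
        using assms(2) D i by (metis card.remove subsetD)
      then show ?thesis using n by (simp add: power2_eq_square)
    qed
    finally show ?thesis .
  qed
  show ?thesis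
  proof (cases "I \<subseteq> J")
    case False
    then show ?thesis using * D by blast
  next
    \<comment> \<open>Here only \<open>J\<close> has an index of its own, so the two sets swap
      roles.\<close>
    case True
    then obtain i where "i \<in> J" "i \<notin> I" using D by blast
    then show ?thesis using *[of J I i] D by (simp add: Int_commute)
  qed
qed

text \<open>By inclusion-exclusion for two sets, adding a set to a union of \<open>m\<close> sets
  costs at most their overlap, which is at most \<open>m * c\<close>. The square of
  \<open>card P\<close> is a crude replacement for the number of pairs; only a constant independent
  of \<open>n\<close> matters later.\<close>

lemma bonferroni_lower_uniform:
  fixes A :: "'i \<Rightarrow> 'b set" and c :: real
  assumes "finite P" "\<And>i. i \<in> P \<Longrightarrow> finite (A i)" "c \<ge> 0"
    and "\<And>i j. i \<in> P \<Longrightarrow> j \<in> P \<Longrightarrow> i \<noteq> j \<Longrightarrow> real (card (A i \<inter> A j)) \<le> c"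
  shows "(\<Sum>i\<in>P. real (card (A i))) \<le> real (card (\<Union>i\<in>P. A i)) + real (card P) ^ 2 * c"
  using assms
proof (induction P rule: finite_induct)
  case empty
  then show ?case by simp
next
  case (insert i P)
  let ?U = "\<Union>j\<in>P. A j" and ?m = "real (card P)"
  have "A i \<inter> ?U = (\<Union>j\<in>P. A i \<inter> A j)" by auto
  then have "real (card (A i \<inter> ?U)) \<le> (\<Sum>j\<in>P. real (card (A i \<inter> A j)))"
    using card_UN_le[OF insert.hyps(1), of "\<lambda>j. A i \<inter> A j"] by (simp flip: of_nat_sum)
  also have "\<dots> \<le> ?m * c"
    using insert.prems(3) insert.hyps by (intro sum_bounded_above) auto
  finally have inter: "real (card (A i \<inter> ?U)) \<le> ?m * c" .
  have "card (A i) + card ?U = card (A i \<union> ?U) + card (A i \<inter> ?U)"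
    using insert by (intro card_Un_Int) auto
  moreover have "(\<Sum>j\<in>P. real (card (A j))) \<le> real (card ?U) + ?m ^ 2 * c"
    using insert by simp
  \<comment> \<open>The new overlap and the old error together fit into the square for one more
    set.\<close>
  moreover have "?m * c + ?m ^ 2 * c \<le> (?m + 1) ^ 2 * c"
    using insert.prems(2) by (simp add: power2_eq_square algebra_simps)
  ultimately show ?case
    using inter insert.hyps by (simp add: add.commute)
qed

text \<open>Replacing ring sums by divisibility of integer sums puts the set in the form of a
  complement of a union, ready for Bonferroni.\<close>

lemma zsf_vectors_eq:
  assumes "n > 1"
  shows "zsf_vectors d n = ({1..d} \<rightarrow>\<^sub>E {0..<int n}) -
    (\<Union>I\<in>Pow {1..d} - {{}}. {v \<in> {1..d} \<rightarrow>\<^sub>E {0..<int n}. int n dvd sum v I})"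
proof -
  interpret residues "int n" "residue_ring (int n)"
    by unfold_locales (use assms in auto)
  have carrier: "carrier (residue_ring (int n)) = {0..<int n}"
    by (auto simp: res_carrier_eq)
  have "finsum (residue_ring (int n)) v I = \<zero>\<^bsub>residue_ring (int n)\<^esub> \<longleftrightarrow> int n dvd sum v I"
    if "v \<in> {1..d} \<rightarrow>\<^sub>E {0..<int n}" "I \<subseteq> {1..d}" for v I
  proof -
    have "finsum (residue_ring (int n)) v I = sum v I mod int n"
      using assms that by (intro finsum_residue_ring) (auto intro: finite_subset)
    then show ?thesis by (simp add: res_zero_eq dvd_eq_mod_eq_0)
  qed
  then show ?thesis
    unfolding zsf_vectors_def zero_sum_free_def carrier by auto
qed

lemma \<alpha>_bounds:
  fixes d n :: nat
  assumes n: "n > 1"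
  defines "M \<equiv> 2 ^ d - 1 :: real"
  shows "\<alpha> d n \<ge> real n ^ d - M * (real n ^ d / n)"
    and "\<alpha> d n \<le> real n ^ d - M * (real n ^ d / n) + M\<^sup>2 * (real n ^ d / real n ^ 2)"
proof -
  define A where "A I = {v \<in> {1..d} \<rightarrow>\<^sub>E {0..<int n}. int n dvd sum v I}" for I
  define P where "P = Pow {1..d} - {{}}"
  define X where "X = {1..d} \<rightarrow>\<^sub>E {0..<int n}"
  have finX: "finite X" by (auto simp: X_def intro!: finite_PiE)
  have subX: "(\<Union>I\<in>P. A I) \<subseteq> X" by (auto simp: A_def X_def)
  have finA: "finite (A I)" for I
    by (rule finite_subset[OF _ finX]) (auto simp: A_def X_def)
  have finP: "finite P" by (simp add: P_def)
  have cardP: "real (card P) = M"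
    by (simp add: P_def M_def card_Diff_subset card_Pow of_nat_diff)
  have cardX: "card X = n ^ d" by (simp add: X_def card_PiE)
  have \<alpha>: "real (\<alpha> d n) = real n ^ d - real (card (\<Union>I\<in>P. A I))"
  proof -
    have "\<alpha> d n = card (X - (\<Union>I\<in>P. A I))"
      unfolding \<alpha>_def zsf_vectors_eq[OF n] A_def P_def X_def ..
    then show ?thesis
      using card_mono[OF finX subX] finite_subset[OF subX finX] subX cardX
      by (simp add: card_Diff_subset of_nat_diff)
  qed
  have "real (card (A I)) = real n ^ d / n" if "I \<in> P" for I
    using card_zero_sum[of n "{1..d}" I] n that by (auto simp: A_def P_def)
  then have sumA: "(\<Sum>I\<in>P. real (card (A I))) = M * (real n ^ d / n)"
    by (simp add: cardP)
  \<comment> \<open>Subadditivity bounds the removed vectors from above; the pairwise intersections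
    below bound them from below.\<close>
  have "real (card (\<Union>I\<in>P. A I)) \<le> (\<Sum>I\<in>P. real (card (A I)))"
    using card_UN_le[OF finP, of A] by (simp flip: of_nat_sum)
  then show "\<alpha> d n \<ge> real n ^ d - M * (real n ^ d / n)"
    using \<alpha> sumA by simp
  have "real (card (A I \<inter> A J)) \<le> real n ^ d / real n ^ 2" if "I \<in> P" "J \<in> P" "I \<noteq> J" for I J
    using card_two_zero_sums[of n "{1..d}" I J] n that by (auto simp: A_def P_def)
  then have "(\<Sum>I\<in>P. real (card (A I))) \<le>
      real (card (\<Union>I\<in>P. A I)) + real (card P) ^ 2 * (real n ^ d / real n ^ 2)"
    using finP finA by (intro bonferroni_lower_uniform) auto
  then show "\<alpha> d n \<le> real n ^ d - M * (real n ^ d / n) + M\<^sup>2 * (real n ^ d / real n ^ 2)"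
    using \<alpha> sumA cardP by simp
qed

theorem theorem6p2:
  fixes d :: nat
  assumes "d > 0"
  shows "\<exists>N::nat. \<forall>n\<ge>N. \<alpha> d (n + 1) > \<alpha> d n"
proof (intro exI allI impI)
  fix n :: nat
  \<comment> \<open>The square makes \<open>M\<^sup>2 / n\<close> smaller than 1; the added 2 makes
    this strict and gives \<open>n > 1\<close>.\<close>
  assume N: "n \<ge> (2 ^ d - 1)\<^sup>2 + 2"
  obtain e where d: "d = Suc e" using assms by (cases d) auto
  define M :: real where "M = 2 ^ d - 1"
  have M1: "M \<ge> 1" using assms by (simp add: M_def self_le_power d)
  have "real n \<ge> real ((2 ^ d - 1)\<^sup>2 + 2)" using N by linarith
  then have nM: "real n \<ge> M\<^sup>2 + 2" by (simp add: M_def of_nat_diff)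
  \<comment> \<open>This leads to \<open>n \<ge> M\<close>, so the factor \<open>n + 1 - M\<close>
    is nonnegative when \<open>n ^ e\<close> is enlarged to \<open>(n + 1) ^ e\<close>.\<close>
  moreover have "M \<le> M\<^sup>2" using M1 by (simp add: power2_eq_square)
  ultimately have "real n \<ge> M" by linarith
  have n1: "n > 1" using N by simp
  have "real (\<alpha> d n) \<le> real n ^ e * (real n - M + M\<^sup>2 / real n)"
    using \<alpha>_bounds(2)[of n d] n1 by (simp add: d M_def field_simps power2_eq_square)
  \<comment> \<open>The strict gain comes from here: the second-order error
    \<open>M\<^sup>2 / n\<close> is below 1, the growth of the linear factor from \<open>n\<close>
    to \<open>n + 1\<close>.\<close>
  also have "\<dots> < real n ^ e * (real n + 1 - M)"
    using nM n1 by (intro mult_strict_left_mono) (auto simp: field_simps)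
  also have "\<dots> \<le> (real n + 1) ^ e * (real n + 1 - M)"
    using \<open>real n \<ge> M\<close> by (intro mult_right_mono power_mono) auto
  also have "\<dots> = real (n + 1) ^ d - M * (real (n + 1) ^ d / real (n + 1))"
  proof -
    have "x ^ e * (x - M) = x ^ d - M * (x ^ d / x)" if "x \<noteq> 0" for x
      using that by (simp add: d field_simps)
    from this[of "real (n + 1)"] show ?thesis by (simp add: add.commute)
  qed
  also have "\<dots> \<le> real (\<alpha> d (n + 1))"
    using \<alpha>_bounds(1)[of "n + 1" d] n1 by (simp add: M_def)
  finally show "\<alpha> d (n + 1) > \<alpha> d n" by simp
qed

end
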